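(* Assume the law of excluded middle. Then the function $\mathsf{BtoO} : \mathsf{Brw} \to \mathsf{Ord}$ is a simulation from $(\mathsf{Brw}, <)$ to $(\mathsf{Ord}, <)$: it is monotone ($a < a' \to \mathsf{BtoO}(a) < \mathsf{BtoO}(a')$), and for all $a : \mathsf{Brw}$ and $B : \mathsf{Ord}$ with $B < \mathsf{BtoO}(a)$ there is $a' : \mathsf{Brw}$ with $a' < a$ and $\mathsf{BtoO}(a') = B$.
   Context: Work in homotopy type theory (univalent). The law of excluded middle: for every proposition $P$, $P \uplus \neg P$. Brouwer trees: $\mathsf{Brw}$ is the quotient inductive-inductive type defined simultaneously with $\leq\, : \mathsf{Brw}\to\mathsf{Brw}\to\mathsf{hProp}$, $x<y := \mathsf{succ}\,x \leq y$; $\mathbb{N}\to_<\mathsf{Brw}$ is the type of sequences with $f(k)<f(k+1)$; constructors $\mathsf{zero}$, $\mathsf{succ}$, $\mathsf{limit} : (\mathbb{N}\to_<\mathsf{Brw})\to\mathsf{Brw}$, $\mathsf{bisim}$ identifying $\mathsf{limit}\,f$ and $\mathsf{limit}\,g$ whenever $\forall k\exists n. f(k)\leq g(n)$ and $\forall k \exists n. g(k)\leq f(n)$, and set truncation; $\leq$ has constructors $\mathsf{zero}\leq x$, transitivity, $x\leq y\to\mathsf{succ}\,x\leq\mathsf{succ}\,y$, $x\leq f(k)\to x\leq\mathsf{limit}\,f$, $(\forall k. f(k)\leq x)\to \mathsf{limit}\,f\leq x$, and propositional truncation. $\mathsf{Ord}$ is the type of pairs $(X,\prec)$ with $X$ a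 type and $\prec$ a proposition-valued relation that is extensional, wellfounded and transitive. A simulation $f : X \to Y$ is a monotone map such that for $y \prec_Y f x$ there is $x_0 \prec_X x$ with $f x_0 = y$; $X \leq Y$ is the type of simulations; $Y_{/y} := \Sigma(y':Y). y' \prec_Y y$; $X < Y$ is the type of simulations inducing $X \simeq Y_{/y}$ for some $y$. $\mathsf{BtoO}(a) := \Sigma(y : \mathsf{Brw}).\,(y < a)$ with order $(y,p) \prec (y',p')$ iff $y < y'$ (this is an element of $\mathsf{Ord}$). *)

theory Defs
  imports Main
begin

section \<open>Brouwer trees\<close>

text \<open>
  The quotient inductive-inductive type of Brouwer trees is presented as a quotient of raw trees.
  Three judgements on raw trees are generated simultaneously: being well formed (every sequence
  under a limit is strictly increasing), being identified, and \<open>\<le>\<close>. The rules for the second are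
  those of a congruence together with \<open>bisim\<close>; the rules for the third are the constructors of
  \<open>\<le>\<close> together with invariance under identification.
\<close>

datatype tree = Zero | Succ tree | Limit "nat \<Rightarrow> tree"

inductive tree_wf :: "tree \<Rightarrow> bool"
  and tree_eq :: "tree \<Rightarrow> tree \<Rightarrow> bool"
  and tree_le :: "tree \<Rightarrow> tree \<Rightarrow> bool"
where
  wf_Zero: "tree_wf Zero"
| wf_Succ: "tree_wf x \<Longrightarrow> tree_wf (Succ x)"
| wf_Limit: "(\<And>k. tree_wf (f k)) \<Longrightarrow> (\<And>k. tree_le (Succ (f k)) (f (Suc k))) \<Longrightarrow> tree_wf (Limit f)"

| eq_refl: "tree_wf x \<Longrightarrow> tree_eq x x"
| eq_sym: "tree_eq x y \<Longrightarrow> tree_eq y x"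
| eq_trans: "tree_eq x y \<Longrightarrow> tree_eq y z \<Longrightarrow> tree_eq x z"
| eq_Succ: "tree_eq x y \<Longrightarrow> tree_eq (Succ x) (Succ y)"
| eq_Limit: "tree_wf (Limit f) \<Longrightarrow> tree_wf (Limit g) \<Longrightarrow> (\<And>k. tree_eq (f k) (g k)) \<Longrightarrow>
    tree_eq (Limit f) (Limit g)"
| eq_bisim: "tree_wf (Limit f) \<Longrightarrow> tree_wf (Limit g) \<Longrightarrow>
    (\<And>k. \<exists>n. tree_le (f k) (g n)) \<Longrightarrow> (\<And>k. \<exists>n. tree_le (g k) (f n)) \<Longrightarrow>
    tree_eq (Limit f) (Limit g)"

| le_Zero: "tree_wf x \<Longrightarrow> tree_le Zero x"
| le_trans: "tree_le x y \<Longrightarrow> tree_le y z \<Longrightarrow> tree_le x z"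
| le_Succ: "tree_le x y \<Longrightarrow> tree_le (Succ x) (Succ y)"
| le_cocone: "tree_wf (Limit f) \<Longrightarrow> tree_le x (f k) \<Longrightarrow> tree_le x (Limit f)"
| le_limiting: "tree_wf (Limit f) \<Longrightarrow> (\<And>k. tree_le (f k) x) \<Longrightarrow> tree_le (Limit f) x"
| le_eq: "tree_eq x x' \<Longrightarrow> tree_le x y \<Longrightarrow> tree_eq y y' \<Longrightarrow> tree_le x' y'"

lemma tree_wf_of:
  "tree_wf z \<Longrightarrow> True"
  "tree_eq x y \<Longrightarrow> tree_wf x \<and> tree_wf y"
  "tree_le x y \<Longrightarrow> tree_wf x \<and> tree_wf y"
  by (induction rule: tree_wf_tree_eq_tree_le.inducts)
    (auto intro: tree_wf_tree_eq_tree_le.intros)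

lemma tree_eq_self_iff: "tree_eq x x \<longleftrightarrow> tree_wf x"
  using tree_wf_of(2) eq_refl by blast

quotient_type brw = tree / partial: tree_eq
proof (rule part_equivpI)
  show "\<exists>x. tree_eq x x" using wf_Zero eq_refl by blast
  show "symp tree_eq" by (auto intro: sympI eq_sym)
  show "transp tree_eq" by (auto intro: transpI eq_trans)
qed

lift_definition zero :: brw is Zero
  by (rule eq_refl[OF wf_Zero])

lift_definition succ :: "brw \<Rightarrow> brw" is Succ
  by (rule eq_Succ)

instantiation brw :: ord
begin

lift_definition less_eq_brw :: "brw \<Rightarrow> brw \<Rightarrow> bool" is tree_le
  by (blast intro: le_eq eq_sym)

definition less_brw :: "brw \<Rightarrow> brw \<Rightarrow> bool" where
  "x < y \<longleftrightarrow> succ x \<le> y"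

instance ..

end

text \<open>The value of \<open>limit f\<close> is meaningful only for \<open>increasing f\<close>.\<close>

definition increasing :: "(nat \<Rightarrow> brw) \<Rightarrow> bool" where
  "increasing f \<longleftrightarrow> (\<forall>k. f k < f (Suc k))"

definition limit :: "(nat \<Rightarrow> brw) \<Rightarrow> brw" where
  "limit f = abs_brw (Limit (\<lambda>k. rep_brw (f k)))"

text \<open>The constructors of the quotient inductive-inductive type, and the induction principles for
  trees and for \<open>\<le>\<close>:\<close>

lemma wf_rep: "tree_wf (rep_brw x)"
  using Quotient_rep_reflp[OF Quotient_brw, of x] by (simp add: tree_eq_self_iff)

lemma abs_rep: "abs_brw (rep_brw x) = x"
  by (rule Quotient_abs_rep[OF Quotient_brw])

lemma rep_abs: "tree_wf t \<Longrightarrow> tree_eq (rep_brw (abs_brw t)) t"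
  by (rule Quotient_rep_abs[OF Quotient_brw]) (rule eq_refl)

lemma abs_eqI: "tree_eq s t \<Longrightarrow> abs_brw s = abs_brw t"
  by (rule Quotient_rel_abs[OF Quotient_brw])

lemma le_rep_iff: "x \<le> y \<longleftrightarrow> tree_le (rep_brw x) (rep_brw y)"
  by (simp add: less_eq_brw.rep_eq)

lemma less_rep_iff: "x < y \<longleftrightarrow> tree_le (Succ (rep_brw x)) (rep_brw y)"
proof -
  have "succ x = abs_brw (Succ (rep_brw x))"
    by (simp add: succ_def)
  then have "tree_eq (rep_brw (succ x)) (Succ (rep_brw x))"
    using rep_abs[OF wf_Succ[OF wf_rep]] by simp
  then show ?thesis
    unfolding less_brw_def le_rep_iff
    using le_eq eq_sym eq_refl[OF wf_rep] by blast
qed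

lemma wf_limit: "increasing f \<Longrightarrow> tree_wf (Limit (\<lambda>k. rep_brw (f k)))"
  by (rule wf_Limit) (auto simp: increasing_def less_rep_iff wf_rep)

lemma rep_limit: "increasing f \<Longrightarrow> tree_eq (rep_brw (limit f)) (Limit (\<lambda>k. rep_brw (f k)))"
  unfolding limit_def by (rule rep_abs[OF wf_limit])

lemma brw_zero_le: "zero \<le> (x :: brw)"
  by (metis abs_rep less_eq_brw.abs_eq zero_def wf_rep wf_Zero eq_refl le_Zero)

lemma brw_le_trans: "x \<le> y \<Longrightarrow> y \<le> z \<Longrightarrow> x \<le> (z :: brw)"
  unfolding le_rep_iff by (rule le_trans)

lemma brw_succ_mono: "x \<le> y \<Longrightarrow> succ x \<le> succ y"
  by transfer (rule le_Succ)

lemma brw_cocone: "increasing f \<Longrightarrow> x \<le> f k \<Longrightarrow> x \<le> limit f"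
  unfolding le_rep_iff
  by (rule le_eq[OF eq_refl[OF wf_rep] le_cocone[OF wf_limit] eq_sym[OF rep_limit]])

lemma brw_limiting: "increasing f \<Longrightarrow> (\<And>k. f k \<le> x) \<Longrightarrow> limit f \<le> x"
  unfolding le_rep_iff
  by (rule le_eq[OF eq_sym[OF rep_limit] le_limiting[OF wf_limit] eq_refl[OF wf_rep]])

lemma brw_bisim:
  assumes "increasing f" "increasing g" "\<And>k. \<exists>n. f k \<le> g n" "\<And>k. \<exists>n. g k \<le> f n"
  shows "limit f = limit g"
  unfolding limit_def using assms
  by (intro abs_eqI eq_bisim wf_limit) (auto simp: le_rep_iff)

lemma abs_Limit:
  assumes "tree_wf (Limit f)"
  shows "increasing (\<lambda>k. abs_brw (f k))" "abs_brw (Limit f) = limit (\<lambda>k. abs_brw (f k))"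
proof -
  have f: "tree_wf (f k)" "tree_le (Succ (f k)) (f (Suc k))" for k
    using assms by (auto elim: tree_wf.cases)
  have g: "tree_eq (rep_brw (abs_brw (f k))) (f k)" for k
    by (rule rep_abs[OF f(1)])
  show inc: "increasing (\<lambda>k. abs_brw (f k))"
    unfolding increasing_def less_rep_iff
    using le_eq[OF eq_sym[OF eq_Succ[OF g]] f(2) eq_sym[OF g]] by blast
  show "abs_brw (Limit f) = limit (\<lambda>k. abs_brw (f k))"
    unfolding limit_def by (intro abs_eqI eq_sym[OF eq_Limit] wf_limit[OF inc] assms g)
qed

lemma brw_induct [case_names zero succ limit]:
  assumes z: "P zero" and s: "\<And>x. P x \<Longrightarrow> P (succ x)"
    and l: "\<And>f. increasing f \<Longrightarrow> (\<And>k. P (f k)) \<Longrightarrow> P (limit f)"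
  shows "P x"
proof -
  have "P (abs_brw t)" if "tree_wf t" for t
    using that
  proof (induction t rule: tree.induct)
    case Zero
    then show ?case using z by (simp add: zero_def)
  next
    case (Succ t)
    then have t: "tree_wf t" by (auto elim: tree_wf.cases)
    then have "succ (abs_brw t) = abs_brw (Succ t)"
      by (simp add: succ.abs_eq eq_refl)
    then show ?case using s[OF Succ.IH[OF t]] by simp
  next
    case (Limit f)
    then have f: "tree_wf (f k)" for k
      by (auto elim: tree_wf.cases)
    show ?case
      unfolding abs_Limit(2)[OF Limit.prems]
      using l[OF abs_Limit(1)[OF Limit.prems] Limit.IH[OF rangeI f]] .
  qed
  from this[OF wf_rep, of x] show ?thesis by (simp add: abs_rep)
qed

lemma brw_le_induct [consumes 1, case_names zero trans succ cocone limiting]: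
  assumes xy: "x \<le> y" and z: "\<And>x. R zero x"
    and t: "\<And>x y z. R x y \<Longrightarrow> R y z \<Longrightarrow> R x z"
    and s: "\<And>x y. R x y \<Longrightarrow> R (succ x) (succ y)"
    and c: "\<And>f x k. increasing f \<Longrightarrow> R x (f k) \<Longrightarrow> R x (limit f)"
    and l: "\<And>f x. increasing f \<Longrightarrow> (\<And>k. R (f k) x) \<Longrightarrow> R (limit f) x"
  shows "R x y"
proof -
  have "tree_wf u \<Longrightarrow> True" "tree_eq v w \<Longrightarrow> True"
    "tree_le a b \<Longrightarrow> R (abs_brw a) (abs_brw b)" for u v w a b
  proof (induction rule: tree_wf_tree_eq_tree_le.inducts)
    case (le_Zero x)
    then show ?case using z by (simp add: zero_def)
  next
    case (le_trans x y z)
    then show ?case using t by blast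
  next
    case (le_Succ x y)
    then have "tree_wf x" "tree_wf y" using tree_wf_of(3) by auto
    then show ?case using s[OF le_Succ.IH] by (simp add: succ.abs_eq eq_refl)
  next
    case (le_cocone f x k)
    then show ?case using c[OF abs_Limit(1)] abs_Limit(2) by metis
  next
    case (le_limiting f x)
    then show ?case using l[OF abs_Limit(1)] abs_Limit(2) by metis
  next
    case (le_eq x x' y y')
    then show ?case using abs_eqI by metis
  qed simp_all
  from this(3)[of "rep_brw x" "rep_brw y"] xy show ?thesis
    by (simp add: le_rep_iff abs_rep)
qed

section \<open>Ordinals\<close>

text \<open>A carrier \<open>X\<close> together with the relation \<open>{(x, y). x \<prec> y}\<close> on it.\<close>

type_synonym 'a order = "'a set \<times> ('a \<times> 'a) set"

definition ordinal :: "'a order \<Rightarrow> bool" where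
  "ordinal = (\<lambda>(X, r). r \<subseteq> X \<times> X \<and>
     (\<forall>x\<in>X. \<forall>y\<in>X. (\<forall>z\<in>X. (z, x) \<in> r \<longleftrightarrow> (z, y) \<in> r) \<longrightarrow> x = y) \<and>
     wf r \<and> trans r)"

definition simulation :: "'a order \<Rightarrow> 'b order \<Rightarrow> ('a \<Rightarrow> 'b) \<Rightarrow> bool" where
  "simulation = (\<lambda>(X, r) (Y, s) f. f ` X \<subseteq> Y \<and>
     (\<forall>x\<in>X. \<forall>x'\<in>X. (x, x') \<in> r \<longrightarrow> (f x, f x') \<in> s) \<and>
     (\<forall>x\<in>X. \<forall>y\<in>Y. (y, f x) \<in> s \<longrightarrow> (\<exists>x\<^sub>0\<in>X. (x\<^sub>0, x) \<in> r \<and> f x\<^sub>0 = y)))"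

definition bounded_simulation :: "'a order \<Rightarrow> 'b order \<Rightarrow> ('a \<Rightarrow> 'b) \<Rightarrow> bool" where
  "bounded_simulation S T f \<longleftrightarrow> simulation S T f \<and>
     (\<exists>y\<in>fst T. bij_betw f (fst S) {y'\<in>fst T. (y', y) \<in> snd T})"

definition isomorphic :: "'a order \<Rightarrow> 'b order \<Rightarrow> bool" where
  "isomorphic = (\<lambda>(X, r) (Y, s). \<exists>f. bij_betw f X Y \<and>
     (\<forall>x\<in>X. \<forall>x'\<in>X. (x, x') \<in> r \<longleftrightarrow> (f x, f x') \<in> s))"

text \<open>
  By univalence, equality in the type of ordinals is isomorphism. A type \<open>'u\<close> plays the role of
  the universe: the ordinals in it are the isomorphism classes of ordinals with carrier in \<open>'u\<close>.
  The class of \<open>S\<close> is formed for \<open>S\<close> over any type \<open>'a\<close>; it is empty, hence not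
  in \<open>Ord\<close>, unless \<open>S\<close> is an ordinal with an isomorphic copy in \<open>'u\<close>.
\<close>

definition ord_class :: "'a order \<Rightarrow> 'u order set" where
  "ord_class S = {T. ordinal T \<and> isomorphic T S}"

definition Ord :: "'u order set set" where
  "Ord = {ord_class S |S :: 'u order. ordinal S}"

definition Ord_less :: "('u order set \<times> 'u order set) set" where
  "Ord_less = {(A, B). A \<in> Ord \<and> B \<in> Ord \<and> (\<exists>S\<in>A. \<exists>T\<in>B. \<exists>f. bounded_simulation S T f)}"

definition BtoO :: "brw \<Rightarrow> 'u order set" where
  "BtoO a = ord_class ({y. y < a}, {(y, y'). y < a \<and> y' < a \<and> y < y'})"

end

theory Submission
  imports Defs
begin

text \<open>
  The strict order on Brouwer trees satisfies \<open>z < succ x \<longleftrightarrow> z \<le> x\<close> and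
  \<open>z < limit f \<longleftrightarrow> (\<exists>k. z < f k)\<close>. To see this, interpret a raw tree as a set of Brouwer trees by
  reading these equations as a recursion, and check that the interpretation respects the generating
  rules of the three judgements. Wellfoundedness, antisymmetry and extensionality follow, so
  \<open>BtoO a\<close> is an ordinal. If \<open>f\<close> is a bounded simulation of \<open>S\<close> into a copy of \<open>BtoO a\<close>, the bound
  corresponds to some \<open>a' < a\<close>, and \<open>f\<close> becomes an isomorphism of \<open>S\<close> with \<open>BtoO a'\<close>.
\<close>

section \<open>The order on Brouwer trees\<close>

lemma brw_refl: "x \<le> (x :: brw)"
proof (induction x rule: brw_induct)
  case (limit f)
  then show ?case by (intro brw_limiting brw_cocone)
qed (simp_all add: brw_zero_le brw_succ_mono)

lemma brw_le_succ: "x \<le> succ x"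
proof (induction x rule: brw_induct)
  case (limit f)
  \<comment> \<open>Chain \<open>f k \<le> succ (f k) \<le> succ (limit f)\<close>: induction
    hypothesis, then monotonicity of \<open>succ\<close>.\<close>
  have "f k \<le> succ (limit f)" for k
    using limit(2)[of k] brw_succ_mono[OF brw_cocone[OF limit(1) brw_refl]] brw_le_trans by blast
  then show ?case by (rule brw_limiting[OF limit(1)])
qed (auto intro: brw_zero_le brw_succ_mono)

lemma brw_less_imp_le: "x < y \<Longrightarrow> x \<le> (y :: brw)"
  unfolding less_brw_def using brw_le_succ brw_le_trans by blast

lemma brw_less_le_trans: "x < y \<Longrightarrow> y \<le> z \<Longrightarrow> x < (z :: brw)"
  unfolding less_brw_def by (rule brw_le_trans)

lemma brw_less_trans: "x < y \<Longrightarrow> y < z \<Longrightarrow> x < (z :: brw)"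
  using brw_less_le_trans brw_less_imp_le by blast

lemma brw_less_limit: "increasing f \<Longrightarrow> f k < limit f"
  using brw_less_le_trans[OF _ brw_cocone[OF _ brw_refl], of "f k" f "Suc k"]
  by (simp add: increasing_def)

text \<open>Recursion is available on raw trees, whereas on the quotient a limit clause would first
  have to respect \<open>bisim\<close>. The successor clause refers to the order on the quotient
  instead of recursing.\<close>

primrec below :: "tree \<Rightarrow> brw set" where
  "below Zero = {}"
| "below (Succ t) = {z. z \<le> abs_brw t}"
| "below (Limit f) = (\<Union>k. below (f k))"

text \<open>One simultaneous induction over the three judgements. Transitivity becomes transitivity
  of inclusion, the limit rules become the universal property of unions, and only the successor rule
  needs transitivity of \<open>\<le>\<close> itself.\<close>

lemma below_invariant:
  "tree_wf t \<Longrightarrow> True"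
  "tree_eq s t \<Longrightarrow> below s = below t"
  "tree_le s t \<Longrightarrow> below s \<subseteq> below t"
proof (induction rule: tree_wf_tree_eq_tree_le.inducts)
  case (eq_Succ x y)
  then show ?case using abs_eqI by auto
next
  case (eq_bisim f g)
  then have "below (f k) \<subseteq> below (Limit g)" "below (g k) \<subseteq> below (Limit f)" for k
    by (simp_all, meson UN_upper UNIV_I subset_trans, meson UN_upper UNIV_I subset_trans)
  then show ?case by (simp add: UN_subset_iff subset_antisym)
next
  case (le_Succ x y)
  then have "abs_brw x \<le> abs_brw y"
    using tree_wf_of(3) by (simp add: less_eq_brw.abs_eq eq_refl)
  then show ?case using brw_le_trans by auto
qed auto

lemma below_abs: "tree_wf t \<Longrightarrow> below (rep_brw (abs_brw t)) = below t"
  by (rule below_invariant(2)[OF rep_abs])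

lemma below_zero: "below (rep_brw zero) = {}"
  by (simp add: zero_def below_abs wf_Zero)

lemma below_succ: "below (rep_brw (succ x)) = {z. z \<le> x}"
proof -
  have "succ x = abs_brw (Succ (rep_brw x))"
    by (simp add: succ_def)
  then show ?thesis by (simp add: below_abs wf_Succ wf_rep abs_rep)
qed

lemma below_limit: "increasing f \<Longrightarrow> below (rep_brw (limit f)) = (\<Union>k. below (rep_brw (f k)))"
  using below_invariant(2)[OF rep_limit] by simp

text \<open>Forwards, \<open>z\<close> lies in the set of \<open>succ z\<close>, which is contained
  in that of \<open>x\<close> by invariance. Backwards, induction on \<open>x\<close> rebuilds the
  inequality constructor by constructor.\<close>

lemma less_iff_below: "z < x \<longleftrightarrow> z \<in> below (rep_brw x)"
proof
  assume "z < x"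
  then have "below (rep_brw (succ z)) \<subseteq> below (rep_brw x)"
    unfolding less_brw_def le_rep_iff by (rule below_invariant(3))
  then show "z \<in> below (rep_brw x)"
    using brw_refl by (auto simp: below_succ)
next
  show "z \<in> below (rep_brw x) \<Longrightarrow> z < x"
  proof (induction x rule: brw_induct)
    case zero
    then show ?case by (simp add: below_zero)
  next
    case (succ x)
    then show ?case by (simp add: below_succ less_brw_def brw_succ_mono)
  next
    case (limit f)
    then obtain k where "z < f k" by (auto simp: below_limit)
    then show ?case unfolding less_brw_def by (rule brw_cocone[OF limit(1)])
  qed
qed

lemma not_less_zero: "\<not> z < zero"
  by (simp add: less_iff_below below_zero)

lemma less_succ_iff: "z < succ x \<longleftrightarrow> z \<le> x"
  by (simp add: less_iff_below below_succ)

lemma less_limit_iff: "increasing f \<Longrightarrow> z < limit f \<longleftrightarrow> (\<exists>k. z < f k)"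
  by (simp add: less_iff_below below_limit)

lemma brw_less_wf: "wf {(x, y :: brw). x < y}"
proof -
  have "Wellfounded.accp (<) x" for x :: brw
  proof (induction x rule: brw_induct)
    case zero
    then show ?case by (auto intro: accp.accI simp: not_less_zero)
  next
    case (succ x)
    show ?case
    proof (rule accp.accI)
      fix z
      assume "z < succ x"
      \<comment> \<open>Only \<open>z \<le> x\<close> is known, so the accessibility of
        \<open>x\<close> does not reach \<open>z\<close> itself, but it reaches every predecessor of
        \<open>z\<close>.\<close>
      then have "w < x" if "w < z" for w
        using that brw_less_le_trans by (auto simp: less_succ_iff)
      then show "Wellfounded.accp (<) z"
        using accp_downward[OF succ] by (auto intro: accp.accI)
    qed
  next
    case (limit f)
    show ?case
    proof (rule accp.accI)
      fix z
      assume "z < limit f"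
      then show "Wellfounded.accp (<) z"
        using accp_downward[OF limit(2)] less_limit_iff[OF limit(1)] by blast
    qed
  qed
  then show ?thesis using accp_wfpI[of "(<) :: brw \<Rightarrow> _"] by (simp add: wfp_def)
qed

lemma brw_less_irrefl: "\<not> x < (x :: brw)"
  using wf_not_refl[OF brw_less_wf, of x] by simp

section \<open>Antisymmetry and extensionality\<close>

lemma brw_le_zero: "x \<le> zero \<Longrightarrow> x = zero"
proof (induction x rule: brw_induct)
  case (succ x)
  then show ?case using not_less_zero by (simp add: less_brw_def)
next
  case (limit f)
  then show ?case
    using not_less_zero brw_less_le_trans[OF brw_less_limit] by blast
qed simp

lemma limit_le_succ:
  assumes "increasing f" "limit f \<le> succ x"
  shows "limit f \<le> x"
proof (rule brw_limiting[OF assms(1)])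
  show "f k \<le> x" for k
    using brw_less_le_trans[OF brw_less_limit[OF assms(1)] assms(2)] by (simp add: less_succ_iff)
qed

text \<open>Otherwise \<open>succ x \<le> limit f \<le> x\<close>, that is,
  \<open>x < x\<close>.\<close>

lemma limit_neq_succ: "increasing f \<Longrightarrow> limit f \<le> succ x \<Longrightarrow> \<not> succ x \<le> limit f"
  using limit_le_succ brw_less_irrefl brw_le_trans unfolding less_brw_def by blast

text \<open>Supplies one half of the hypotheses of \<open>brw_bisim\<close>: \<open>f k\<close> lies
  strictly below \<open>limit g\<close>, hence strictly below some \<open>g n\<close>.\<close>

lemma limit_le_limit:
  assumes "increasing f" "increasing g" "limit f \<le> limit g"
  shows "\<exists>n. f k \<le> g n"
  using brw_less_le_trans[OF brw_less_limit[OF assms(1)] assms(3)] less_limit_iff[OF assms(2)]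
    brw_less_imp_le by blast

text \<open>Nested induction compares the outermost constructors. Mixed pairs contradict the order
  laws, two successors reduce to their predecessors, and two limits are equal by
  \<open>brw_bisim\<close>.\<close>

lemma brw_antisym: "x \<le> y \<Longrightarrow> y \<le> x \<Longrightarrow> x = (y :: brw)"
proof (induction x arbitrary: y rule: brw_induct)
  case zero
  from brw_le_zero[OF zero(2)] show ?case by (rule sym)
next
  case (succ x)
  note x = succ
  have "succ x \<le> y \<Longrightarrow> y \<le> succ x \<Longrightarrow> succ x = y"
  proof (induction y rule: brw_induct)
    case zero
    from brw_le_zero[OF zero(1)] show ?case .
  next
    case (succ y)
    then have "x \<le> y" "y \<le> x"
      by (simp_all add: less_succ_iff flip: less_brw_def)
    then have "x = y" by (rule x(1))
    then show ?case by simp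
  next
    case (limit f)
    then show ?case using limit_neq_succ by blast
  qed
  then show ?case using x(2,3) .
next
  case (limit f)
  note f = limit
  have "limit f \<le> y \<Longrightarrow> y \<le> limit f \<Longrightarrow> limit f = y"
  proof (induction y rule: brw_induct)
    case zero
    from brw_le_zero[OF zero(1)] show ?case .
  next
    case (succ y)
    then show ?case using limit_neq_succ[OF f(1)] by blast
  next
    case (limit g)
    show ?case
      by (rule brw_bisim[OF f(1) limit(1)])
        (rule limit_le_limit[OF f(1) limit(1,3)], rule limit_le_limit[OF limit(1) f(1) limit(4)])
  qed
  then show ?case using f(3,4) .
qed

text \<open>A case analysis on \<open>x\<close>: it suffices to test the hypothesis at
  \<open>x\<close> for a successor \<open>succ x\<close> and at each \<open>f k\<close> for
  \<open>limit f\<close>. With antisymmetry this yields extensionality.\<close>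

lemma brw_le_if_less_imp_less: "(\<And>z. z < x \<Longrightarrow> z < y) \<Longrightarrow> x \<le> (y :: brw)"
proof (induction x rule: brw_induct)
  case zero
  then show ?case by (simp add: brw_zero_le)
next
  case (succ x)
  from succ(2)[of x] show ?case
    by (simp add: less_succ_iff brw_refl flip: less_brw_def)
next
  case (limit f)
  show ?case
    by (rule brw_limiting[OF limit(1) brw_less_imp_le[OF limit(3)[OF brw_less_limit[OF limit(1)]]]])
qed

section \<open>Ordinals and isomorphism\<close>

lemma isomorphic_sym:
  assumes "isomorphic S T"
  shows "isomorphic T S"
proof -
  obtain X r Y s where [simp]: "S = (X, r)" "T = (Y, s)" by (cases S, cases T)
  obtain f where f: "bij_betw f X Y" "\<And>x x'. x \<in> X \<Longrightarrow> x' \<in> X \<Longrightarrow> (x, x') \<in> r \<longleftrightarrow> (f x, f x') \<in> s"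
    using assms unfolding isomorphic_def by auto
  let ?g = "inv_into X f"
  have g: "bij_betw ?g Y X" using f(1) by (rule bij_betw_inv_into)
  have "(y, y') \<in> s \<longleftrightarrow> (?g y, ?g y') \<in> r" if "y \<in> Y" "y' \<in> Y" for y y'
    using f(2)[OF bij_betw_apply[OF g that(1)] bij_betw_apply[OF g that(2)]]
    by (simp add: bij_betw_inv_into_right[OF f(1)] that)
  then show ?thesis using g unfolding isomorphic_def by auto
qed

lemma isomorphic_trans:
  assumes "isomorphic S T" "isomorphic T U"
  shows "isomorphic S U"
proof -
  obtain X r Y s Z t where [simp]: "S = (X, r)" "T = (Y, s)" "U = (Z, t)"
    by (cases S, cases T, cases U)
  obtain f where f: "bij_betw f X Y" "\<And>x x'. x \<in> X \<Longrightarrow> x' \<in> X \<Longrightarrow> (x, x') \<in> r \<longleftrightarrow> (f x, f x') \<in> s"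
    using assms(1) unfolding isomorphic_def by auto
  obtain g where g: "bij_betw g Y Z" "\<And>x x'. x \<in> Y \<Longrightarrow> x' \<in> Y \<Longrightarrow> (x, x') \<in> s \<longleftrightarrow> (g x, g x') \<in> t"
    using assms(2) unfolding isomorphic_def by auto
  have "bij_betw (g \<circ> f) X Z" using f(1) g(1) by (rule bij_betw_trans)
  moreover have "(x, x') \<in> r \<longleftrightarrow> ((g \<circ> f) x, (g \<circ> f) x') \<in> t" if "x \<in> X" "x' \<in> X" for x x'
    using f(2) g(2) that bij_betw_apply[OF f(1)] by simp
  ultimately show ?thesis unfolding isomorphic_def by auto
qed

text \<open>\<open>S\<close> and \<open>T\<close> may live over different types, so the class of an
  order on \<open>brw\<close> can be identified with that of its copy in \<open>'u\<close>.\<close>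

lemma ord_class_cong:
  assumes "isomorphic S T"
  shows "ord_class S = ord_class T"
proof -
  have "isomorphic U S \<longleftrightarrow> isomorphic U T" for U :: "'c order"
    using isomorphic_trans[OF _ assms] isomorphic_trans[OF _ isomorphic_sym[OF assms]] by blast
  then show ?thesis by (simp add: ord_class_def)
qed

text \<open>Initial segments have carriers in \<open>brw\<close>, whereas members of an element of
  \<open>Ord\<close> have carriers in \<open>'u\<close>; an injection provides the copy
  there.\<close>

definition image_order :: "('a \<Rightarrow> 'b) \<Rightarrow> 'a order \<Rightarrow> 'b order" where
  "image_order e = (\<lambda>(X, r). (e ` X, map_prod e e ` r))"

lemma mem_map_prod_image: "inj e \<Longrightarrow> (e x, e y) \<in> map_prod e e ` r \<longleftrightarrow> (x, y) \<in> r"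
  by (force simp: inj_eq)

lemma isomorphic_image_order:
  assumes "inj e"
  shows "isomorphic (image_order e S) S"
proof -
  have "bij_betw e X (e ` X)" for X
    using inj_on_subset[OF assms] by (simp add: bij_betw_def)
  then have "isomorphic S (image_order e S)"
    unfolding isomorphic_def image_order_def
    by (cases S) (simp, rule exI[of _ e], simp add: mem_map_prod_image[OF assms])
  then show ?thesis by (rule isomorphic_sym)
qed

lemma ordinal_image_order:
  assumes "inj e" "ordinal S"
  shows "ordinal (image_order e S)"
proof -
  obtain X r where [simp]: "S = (X, r)" by (cases S)
  let ?r = "map_prod e e ` r"
  have sub: "r \<subseteq> X \<times> X" and "wf r" "trans r"
    and ext: "\<And>x y. x \<in> X \<Longrightarrow> y \<in> X \<Longrightarrow> \<forall>z\<in>X. (z, x) \<in> r \<longleftrightarrow> (z, y) \<in> r \<Longrightarrow> x = y"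
    using assms(2) unfolding ordinal_def by auto
  note mem = mem_map_prod_image[OF assms(1)]
  have "wf ?r" using \<open>wf r\<close> assms(1) by (rule wf_map_prod_image)
  moreover have "trans ?r"
  proof (rule transI)
    fix u v w
    assume "(u, v) \<in> ?r" "(v, w) \<in> ?r"
    then obtain x y z where "u = e x" "v = e y" "w = e z" "(x, y) \<in> r" "(y, z) \<in> r"
      using inj_eq[OF assms(1)] by auto
    then show "(u, w) \<in> ?r" using transD[OF \<open>trans r\<close>] by (auto simp: mem)
  qed
  moreover have "?r \<subseteq> e ` X \<times> e ` X" using sub by auto
  moreover have "e x = e y"
    if "x \<in> X" "y \<in> X" "\<forall>z\<in>e ` X. (z, e x) \<in> ?r \<longleftrightarrow> (z, e y) \<in> ?r" for x y
    using ext[of x y] that by (simp add: mem)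
  ultimately show ?thesis
    unfolding ordinal_def image_order_def by (simp add: Ball_def) blast
qed

text \<open>Both orders are copied along the same \<open>e\<close>, so an inclusion of carriers
  remains an inclusion, bounded by the image of the old bound.\<close>

lemma bounded_simulation_image_order:
  assumes "inj e" "bounded_simulation S T id"
  shows "bounded_simulation (image_order e S) (image_order e T) id"
proof -
  obtain X r Y s where [simp]: "S = (X, r)" "T = (Y, s)" by (cases S, cases T)
  note mem = mem_map_prod_image[OF assms(1)]
  have sim: "simulation (X, r) (Y, s) id"
    using assms(2) by (simp add: bounded_simulation_def)
  then have init: "\<forall>x\<in>X. \<forall>x'\<in>Y. (x', x) \<in> s \<longrightarrow> (\<exists>x\<^sub>0\<in>X. (x\<^sub>0, x) \<in> r \<and> x\<^sub>0 = x')"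
    unfolding simulation_def split id_apply by (elim conjE)
  obtain y where y: "y \<in> Y" "X = {y' \<in> Y. (y', y) \<in> s}"
    using assms(2) by (auto simp: bounded_simulation_def bij_betw_def)
  have sim': "simulation (e ` X, map_prod e e ` r) (e ` Y, map_prod e e ` s) id"
    unfolding simulation_def split image_id id_apply
  proof (intro conjI ballI impI)
    show "e ` X \<subseteq> e ` Y" using y(2) by auto
  next
    fix u v
    assume uv: "(u, v) \<in> map_prod e e ` r" "u \<in> e ` X" "v \<in> e ` X"
    from uv(2,3) obtain x x' where x: "x \<in> X" "x' \<in> X" "u = e x" "v = e x'" by blast
    with uv(1) have "(x, x') \<in> r" by (simp add: mem)
    with x have "(x, x') \<in> s" using sim by (simp add: simulation_def)
    then show "(u, v) \<in> map_prod e e ` s" using x(3,4) by (simp add: mem)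
  next
    fix v u
    assume uv: "(u, v) \<in> map_prod e e ` s" "v \<in> e ` X" "u \<in> e ` Y"
    from uv(2,3) obtain x x' where x: "x \<in> X" "x' \<in> Y" "v = e x" "u = e x'" by blast
    with uv(1) have "(x', x) \<in> s" by (simp add: mem)
    with init x(1,2) have "x' \<in> X \<and> (x', x) \<in> r" by blast
    then show "\<exists>x\<^sub>0\<in>e ` X. (x\<^sub>0, v) \<in> map_prod e e ` r \<and> x\<^sub>0 = u" using x(3,4) by (simp add: mem inj_eq[OF assms(1)])
  qed
  have "{v \<in> e ` Y. (v, e y) \<in> map_prod e e ` s} = e ` X"
  proof (intro subset_antisym subsetI)
    fix v
    assume v: "v \<in> {v \<in> e ` Y. (v, e y) \<in> map_prod e e ` s}"
    then have "v \<in> e ` Y" unfolding mem_Collect_eq by (elim conjE)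
    then obtain x where x: "x \<in> Y" "v = e x" by (rule imageE)
    with v have "(x, y) \<in> s" by (simp add: mem)
    then have "x \<in> X" using x(1) by (simp add: y(2))
    then show "v \<in> e ` X" using x(2) by simp
  next
    fix v
    assume "v \<in> e ` X"
    then obtain x where "x \<in> X" "v = e x" by blast
    moreover from this have "x \<in> Y" "(x, y) \<in> s" by (simp_all add: y(2))
    ultimately show "v \<in> {v \<in> e ` Y. (v, e y) \<in> map_prod e e ` s}" by (simp add: mem)
  qed
  then have "bij_betw id (e ` X) {v \<in> e ` Y. (v, e y) \<in> map_prod e e ` s}"
    by (metis bij_betw_id)
  with sim' imageI[OF y(1)] have "bounded_simulation (e ` X, map_prod e e ` r) (e ` Y, map_prod e e ` s) id"
    unfolding bounded_simulation_def fst_conv snd_conv by (intro conjI bexI)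
  then show ?thesis by (simp add: image_order_def)
qed

text \<open>A bounded simulation identifies its domain with the part of its target below the bound,
  and \<open>g\<close> carries that part to the part of \<open>(Z, t)\<close> below
  \<open>g y\<close>.\<close>

lemma bounded_simulation_isomorphic:
  assumes f: "simulation (X, r) (Y, s) f" "y \<in> Y" "bij_betw f X {y' \<in> Y. (y', y) \<in> s}"
    and g: "bij_betw g Y Z" "\<And>u v. u \<in> Y \<Longrightarrow> v \<in> Y \<Longrightarrow> (u, v) \<in> s \<longleftrightarrow> (g u, g v) \<in> t"
  shows "isomorphic (X, r) ({z \<in> Z. (z, g y) \<in> t}, {(z, z') \<in> t. (z, g y) \<in> t \<and> (z', g y) \<in> t})"
proof -
  have fX: "f x \<in> Y" "(f x, y) \<in> s" if "x \<in> X" for x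
    using that f(3) bij_betw_apply by fastforce+
  have "g ` {y' \<in> Y. (y', y) \<in> s} = {z \<in> Z. (z, g y) \<in> t}"
    using g f(2) unfolding bij_betw_def by auto
  then have "bij_betw g {y' \<in> Y. (y', y) \<in> s} {z \<in> Z. (z, g y) \<in> t}"
    using g(1) by (auto simp: bij_betw_def inj_on_def)
  with f(3) have "bij_betw (g \<circ> f) X {z \<in> Z. (z, g y) \<in> t}"
    by (rule bij_betw_trans)
  moreover have "(x, x') \<in> r \<longleftrightarrow> (f x, f x') \<in> s" if x: "x \<in> X" "x' \<in> X" for x x'
  proof
    show "(x, x') \<in> r \<Longrightarrow> (f x, f x') \<in> s"
      using f(1) x unfolding simulation_def by auto
    \<comment> \<open>The simulation lifts \<open>f x\<close> to some \<open>x0\<close> preceding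
      \<open>x'\<close>, and injectivity gives \<open>x0 = x\<close>.\<close>
    assume "(f x, f x') \<in> s"
    moreover have "\<forall>x\<in>X. \<forall>y\<in>Y. (y, f x) \<in> s \<longrightarrow> (\<exists>x0\<in>X. (x0, x) \<in> r \<and> f x0 = y)"
      using f(1) unfolding simulation_def by simp
    ultimately obtain x0 where "x0 \<in> X" "(x0, x') \<in> r" "f x0 = f x"
      using x fX(1) by blast
    then show "(x, x') \<in> r"
      using f(3) x by (auto simp: bij_betw_def dest: inj_onD)
  qed
  ultimately show ?thesis
    unfolding isomorphic_def using fX f(2) g(2) by (auto intro!: exI[of _ "g \<circ> f"])
qed

section \<open>Initial segments of Brouwer trees\<close>

abbreviation segment :: "brw \<Rightarrow> brw order" where
  "segment a \<equiv> ({y. y < a}, {(y, y'). y < a \<and> y' < a \<and> y < y'})"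

lemma ordinal_segment: "ordinal (segment a)"
proof -
  have "wf {(y, y'). y < a \<and> y' < a \<and> y < y'}"
    by (rule wf_subset[OF brw_less_wf]) auto
  moreover have "trans {(y, y'). y < a \<and> y' < a \<and> y < y'}"
    unfolding trans_def using brw_less_trans by blast
  \<comment> \<open>Comparing predecessors inside the segment is enough: anything below
    \<open>x\<close> or \<open>y\<close> is below \<open>a\<close> by transitivity.\<close>
  moreover have "x = y" if "x < a" "y < a" "\<forall>z. z < a \<longrightarrow> (z < x \<longleftrightarrow> z < y)" for x y
  proof (rule brw_antisym; rule brw_le_if_less_imp_less)
    show "z < y" if "z < x" for z using that \<open>x < a\<close> \<open>\<forall>z. z < a \<longrightarrow> _ z\<close> brw_less_trans by blast
    show "z < x" if "z < y" for z using that \<open>y < a\<close> \<open>\<forall>z. z < a \<longrightarrow> _ z\<close> brw_less_trans by blast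
  qed
  ultimately show ?thesis unfolding ordinal_def by auto
qed

lemma image_segment_in_BtoO:
  "inj e \<Longrightarrow> image_order e (segment a) \<in> BtoO a"
  unfolding BtoO_def ord_class_def
  using ordinal_image_order[OF _ ordinal_segment] isomorphic_image_order by blast

text \<open>The class is that of the copy of the segment along \<open>e\<close>, which is an ordinal
  over \<open>'u\<close>.\<close>

lemma BtoO_in_Ord:
  fixes e :: "brw \<Rightarrow> 'u"
  assumes "inj e"
  shows "(BtoO a :: 'u order set) \<in> Ord"
  unfolding Ord_def BtoO_def
  using ordinal_image_order[OF assms ordinal_segment] ord_class_cong[OF isomorphic_image_order[OF assms]]
  by blast

text \<open>The inclusion works, and its bound is \<open>a\<close>, itself an element of the larger
  segment.\<close>

lemma bounded_simulation_segment:
  assumes "a < a'"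
  shows "bounded_simulation (segment a) (segment a') id"
proof -
  have trans: "y < a'" if "y < a" for y using that assms by (rule brw_less_trans)
  have "simulation (segment a) (segment a') id"
    unfolding simulation_def split image_id id_apply
  proof (intro conjI ballI impI)
    show "{y. y < a} \<subseteq> {y. y < a'}" using trans by auto
    show "(x, x') \<in> {(y, y'). y < a' \<and> y' < a' \<and> y < y'}"
      if "(x, x') \<in> {(y, y'). y < a \<and> y' < a \<and> y < y'}" for x x'
      using that trans by simp
    show "\<exists>x\<^sub>0\<in>{y. y < a}. (x\<^sub>0, x) \<in> {(y, y'). y < a \<and> y' < a \<and> y < y'} \<and> x\<^sub>0 = x'"
      if "x \<in> {y. y < a}" "(x', x) \<in> {(y, y'). y < a' \<and> y' < a' \<and> y < y'}" for x x'
      using that brw_less_trans[of x' x a] by simp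
  qed
  moreover have "{y \<in> {y. y < a'}. (y, a) \<in> {(y, y'). y < a' \<and> y' < a' \<and> y < y'}} = {y. y < a}"
    using assms trans by (auto simp only: mem_Collect_eq split)
  then have "bij_betw id {y. y < a} {y \<in> {y. y < a'}. (y, a) \<in> {(y, y'). y < a' \<and> y' < a' \<and> y < y'}}"
    by (metis bij_betw_id)
  ultimately show ?thesis
    unfolding bounded_simulation_def fst_conv snd_conv
    using assms by (intro conjI bexI[of _ a] CollectI)
qed

lemma BtoO_less:
  fixes e :: "brw \<Rightarrow> 'u"
  assumes "inj e" "a < a'"
  shows "(BtoO a :: 'u order set, BtoO a') \<in> Ord_less"
  unfolding Ord_less_def
  using BtoO_in_Ord[OF assms(1)] image_segment_in_BtoO[OF assms(1)]
    bounded_simulation_image_order[OF assms(1) bounded_simulation_segment[OF assms(2)]] by blast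

lemma less_BtoO:
  fixes B :: "'u order set"
  assumes "(B, BtoO a) \<in> Ord_less"
  shows "\<exists>a'. a' < a \<and> BtoO a' = B"
proof -
  obtain X r Y s f
    where "B \<in> Ord" and S: "(X, r) \<in> B" and T: "(Y, s) \<in> (BtoO a :: 'u order set)"
    and bs: "bounded_simulation (X, r) (Y, s) f"
    using assms unfolding Ord_less_def by auto
  obtain y where f: "simulation (X, r) (Y, s) f" "y \<in> Y" "bij_betw f X {y' \<in> Y. (y', y) \<in> s}"
    using bs unfolding bounded_simulation_def by auto
  obtain g where g: "bij_betw g Y {z. z < a}"
    "\<And>u v. u \<in> Y \<Longrightarrow> v \<in> Y \<Longrightarrow> (u, v) \<in> s \<longleftrightarrow> (g u, g v) \<in> {(z, z'). z < a \<and> z' < a \<and> z < z'}"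
    using T unfolding BtoO_def ord_class_def isomorphic_def by auto
  \<comment> \<open>The required tree is \<open>g y\<close>, the bound \<open>y\<close> read through
    the isomorphism \<open>g\<close> with the segment of \<open>a\<close>.\<close>
  have gy: "g y < a" using f(2) g(1) bij_betw_apply by fastforce
  have trans: "z < a" if "z < g y" for z using that gy by (rule brw_less_trans)
  \<comment> \<open>Cutting the segment of \<open>a\<close> at \<open>g y\<close> leaves exactly the
    segment of \<open>g y\<close>.\<close>
  have "{z \<in> {z. z < a}. (z, g y) \<in> {(z, z'). z < a \<and> z' < a \<and> z < z'}} = {z. z < g y}"
    and "{(z, z') \<in> {(z, z'). z < a \<and> z' < a \<and> z < z'}.
        (z, g y) \<in> {(z, z'). z < a \<and> z' < a \<and> z < z'} \<and>
        (z', g y) \<in> {(z, z'). z < a \<and> z' < a \<and> z < z'}} =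
      {(z, z'). z < g y \<and> z' < g y \<and> z < z'}"
    using trans gy by auto
  then have "isomorphic (X, r) (segment (g y))"
    using bounded_simulation_isomorphic[OF f g] by simp
  \<comment> \<open>An isomorphism class is the class of any of its members.\<close>
  moreover have "B = ord_class (X, r)"
  proof -
    obtain S0 :: "'u order" where B: "B = ord_class S0"
      using \<open>B \<in> Ord\<close> unfolding Ord_def by blast
    then have "isomorphic (X, r) S0" using S by (simp add: ord_class_def)
    then show ?thesis unfolding B by (rule ord_class_cong[symmetric])
  qed
  ultimately have "BtoO (g y) = B"
    unfolding BtoO_def by (simp add: ord_class_cong)
  with gy show ?thesis by blast
qed

text \<open>The injection \<open>e\<close> expresses that the universe \<open>'u\<close> has room
  for the Brouwer trees. Excluded middle is that of the ambient logic.\<close>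

theorem theorem8p9:
  fixes e :: "brw \<Rightarrow> 'u"
  assumes "inj e"
  shows "simulation (UNIV, {(a, a'). a < a'}) (Ord, Ord_less) (BtoO :: brw \<Rightarrow> 'u order set)"
  unfolding simulation_def
  using BtoO_in_Ord[OF assms] BtoO_less[OF assms] less_BtoO by auto

end
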